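(* Let $U\subset S$ and let $i,j,k$ be delay conditions. (a) If $i(u)\cap U\neq\emptyset$ for all $u\in S$, then $(i\circ j)(u)\cap U\neq\emptyset$ for all $u\in S$ and $(i\wedge U)\circ j=(i\circ j)\wedge U$. If $j(u)\cap U\neq\emptyset$ for all $u\in S$, then $i\circ(j\wedge U)\subset i\circ j$. (b) If $i(u)\cap j(u)\neq\emptyset$ for all $u\in S$, then $(i\circ k)(u)\cap(j\circ k)(u)\neq\emptyset$ for all $u$ and $(i\wedge j)\circ k\subset(i\circ k)\wedge(j\circ k)$. If $j(u)\cap k(u)\neq\emptyset$ for all $u\in S$, then $(i\circ j)(u)\cap(i\circ k)(u)\neq\emptyset$ for all $u$ and $i\circ(j\wedge k)\subset(i\circ j)\wedge(i\circ k)$. (c) $(i\vee j)\circ k=(i\circ k)\vee(j\circ k)$ and $i\circ(j\vee k)=(i\circ j)\vee(i\circ k)$.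
   Context: $\mathbf{B}=\{0,1\}$. A signal is a function $x:\mathbf{R}\rightarrow\mathbf{B}$ for which there exists an unbounded sequence $0\leq t_0<t_1<t_2<\dots$ of reals such that $x$ is constant on $(-\infty,t_0)$ and on each interval $[t_k,t_{k+1})$. $S$ is the set of signals and $P^*(S)$ the set of non-empty subsets of $S$. For $u,x\in S$, $(u,x)$ satisfies the stability condition (SC) if for every $a\in\mathbf{B}$: if $u(t)=a$ for all sufficiently large $t$, then $x(t)=a$ for all sufficiently large $t$; $Sol_{SC}(u)=\{x\in S\mid(u,x)\text{ satisfies SC}\}$. A delay condition (DC) is a function $i:S\rightarrow P^*(S)$ with $i(u)\subset Sol_{SC}(u)$ for all $u$. For a DC $i$ and a function $\varphi:S\rightarrow P^*(S)$ (or a set $U\subset S$, viewed as the constant function $u\mapsto U$), $(i\wedge\varphi)(u)=i(u)\cap\varphi(u)$ whenever these intersections are all non-empty, and $(i\vee\varphi)(u)=i(u)\cup\varphi(u)$. For DC's $i,j$, $i\subset j$ means $i(u)\subset j(u)$ for all $u$. The serial connection of DC's $i,j$ is $(i\circ j)(u)=\{y\mid\exists x,\ x\in j(u)\text{ and }y\in i(x)\}$. *)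

theory Defs
  imports "HOL-Analysis.Analysis"
begin

text \<open>The binary set {0, 1} is rendered as \<^typ>\<open>bool\<close>, with 1 as \<^term>\<open>True\<close>.\<close>

definition is_signal :: "(real \<Rightarrow> bool) \<Rightarrow> bool" where
  "is_signal x \<longleftrightarrow>
     (\<exists>t :: nat \<Rightarrow> real. 0 \<le> t 0 \<and> strict_mono t \<and> \<not> bdd_above (range t) \<and>
        x constant_on {..<t 0} \<and> (\<forall>k. x constant_on {t k..<t (Suc k)}))"

typedef signal = "{x. is_signal x}"
  morphisms val Signal
proof -
  have "is_signal (\<lambda>_. False)"
    unfolding is_signal_def
  proof (intro exI[of _ real] conjI allI)
    show "\<not> bdd_above (range real)"
      unfolding bdd_above_def by (auto simp: not_le intro: reals_Archimedean2)
  qed (auto simp: strict_mono_def constant_on_def)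
  then show ?thesis by blast
qed

definition SC :: "signal \<Rightarrow> signal \<Rightarrow> bool" where
  "SC u x \<longleftrightarrow>
     (\<forall>a. (\<forall>\<^sub>F t in at_top. val u t = a) \<longrightarrow> (\<forall>\<^sub>F t in at_top. val x t = a))"

definition Sol_SC :: "signal \<Rightarrow> signal set" where
  "Sol_SC u = {x. SC u x}"

definition delay_condition :: "(signal \<Rightarrow> signal set) \<Rightarrow> bool" where
  "delay_condition i \<longleftrightarrow> (\<forall>u. i u \<noteq> {} \<and> i u \<subseteq> Sol_SC u)"

text \<open>The connectives below are total. The meet denotes a function into the non-empty sets of
  signals only if all the intersections are non-empty; a statement about a meet has to
  assume or assert this separately. A set \<open>U\<close> of signals enters a meet
  as the constant function \<open>\<lambda>_. U\<close>.\<close>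

definition dc_meet ::
    "(signal \<Rightarrow> signal set) \<Rightarrow> (signal \<Rightarrow> signal set) \<Rightarrow> signal \<Rightarrow> signal set"
    (infixl \<open>\<and>\<^sub>D\<close> 70) where
  "(i \<and>\<^sub>D \<phi>) = (\<lambda>u. i u \<inter> \<phi> u)"

definition dc_join ::
    "(signal \<Rightarrow> signal set) \<Rightarrow> (signal \<Rightarrow> signal set) \<Rightarrow> signal \<Rightarrow> signal set"
    (infixl \<open>\<or>\<^sub>D\<close> 65) where
  "(i \<or>\<^sub>D \<phi>) = (\<lambda>u. i u \<union> \<phi> u)"

definition dc_serial ::
    "(signal \<Rightarrow> signal set) \<Rightarrow> (signal \<Rightarrow> signal set) \<Rightarrow> signal \<Rightarrow> signal set"
    (infixl \<open>\<circ>\<^sub>D\<close> 75) where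
  "(i \<circ>\<^sub>D j) = (\<lambda>u. {y. \<exists>x. x \<in> j u \<and> y \<in> i x})"

definition dc_subset ::
    "(signal \<Rightarrow> signal set) \<Rightarrow> (signal \<Rightarrow> signal set) \<Rightarrow> bool"
    (infix \<open>\<subseteq>\<^sub>D\<close> 50) where
  "i \<subseteq>\<^sub>D j \<longleftrightarrow> (\<forall>u. i u \<subseteq> j u)"

text \<open>Under the stated non-emptiness condition for the meet, delay conditions are closed under
  the connectives.\<close>

lemma delay_condition_meet:
  assumes "delay_condition i" and "\<And>u. i u \<inter> \<phi> u \<noteq> {}"
  shows "delay_condition (i \<and>\<^sub>D \<phi>)"
  using assms unfolding delay_condition_def dc_meet_def by blast

lemma delay_condition_join:
  assumes "delay_condition i" and "delay_condition j"
  shows "delay_condition (i \<or>\<^sub>D j)"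
  using assms unfolding delay_condition_def dc_join_def by blast

lemma delay_condition_serial:
  assumes "delay_condition i" and "delay_condition j"
  shows "delay_condition (i \<circ>\<^sub>D j)"
  unfolding delay_condition_def
proof (intro allI conjI)
  fix u
  show "(i \<circ>\<^sub>D j) u \<noteq> {}"
    using assms unfolding delay_condition_def dc_serial_def by blast
  show "(i \<circ>\<^sub>D j) u \<subseteq> Sol_SC u"
    using assms unfolding delay_condition_def dc_serial_def Sol_SC_def SC_def by blast
qed

end

theory Submission
  imports Defs
begin

text \<open>Read a delay condition as a relation between inputs and outputs. Then
  \<open>i \<circ>\<^sub>D j\<close> is relational composition: its value at \<open>u\<close> is the
  union of the sets \<open>i x\<close> over \<open>x\<close> in \<open>j u\<close>. Such a union is
  monotone in both arguments and distributes over joins in either one. Intersecting with a fixed set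
  also commutes with it. A general meet gives only an inclusion, since a signal in both composites
  may be reached through different intermediate signals. Non-emptiness comes from choosing an
  intermediate signal and then an output.\<close>

theorem theorem10p5:
  fixes U :: "signal set" and i j k :: "signal \<Rightarrow> signal set"
  assumes "delay_condition i" and "delay_condition j" and "delay_condition k"
  shows
    "((\<forall>u. i u \<inter> U \<noteq> {}) \<longrightarrow>
        (\<forall>u. (i \<circ>\<^sub>D j) u \<inter> U \<noteq> {}) \<and>
        (i \<and>\<^sub>D (\<lambda>_. U)) \<circ>\<^sub>D j = (i \<circ>\<^sub>D j) \<and>\<^sub>D (\<lambda>_. U))
   \<and> ((\<forall>u. j u \<inter> U \<noteq> {}) \<longrightarrow>
        i \<circ>\<^sub>D (j \<and>\<^sub>D (\<lambda>_. U)) \<subseteq>\<^sub>D i \<circ>\<^sub>D j)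
   \<and> ((\<forall>u. i u \<inter> j u \<noteq> {}) \<longrightarrow>
        (\<forall>u. (i \<circ>\<^sub>D k) u \<inter> (j \<circ>\<^sub>D k) u \<noteq> {}) \<and>
        (i \<and>\<^sub>D j) \<circ>\<^sub>D k \<subseteq>\<^sub>D (i \<circ>\<^sub>D k) \<and>\<^sub>D (j \<circ>\<^sub>D k))
   \<and> ((\<forall>u. j u \<inter> k u \<noteq> {}) \<longrightarrow>
        (\<forall>u. (i \<circ>\<^sub>D j) u \<inter> (i \<circ>\<^sub>D k) u \<noteq> {}) \<and>
        i \<circ>\<^sub>D (j \<and>\<^sub>D k) \<subseteq>\<^sub>D (i \<circ>\<^sub>D j) \<and>\<^sub>D (i \<circ>\<^sub>D k))
   \<and> (i \<or>\<^sub>D j) \<circ>\<^sub>D k = (i \<circ>\<^sub>D k) \<or>\<^sub>D (j \<circ>\<^sub>D k)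
   \<and> i \<circ>\<^sub>D (j \<or>\<^sub>D k) = (i \<circ>\<^sub>D j) \<or>\<^sub>D (i \<circ>\<^sub>D k)"
proof (intro conjI impI)
  have ne: "i u \<noteq> {}" "j u \<noteq> {}" "k u \<noteq> {}" for u
    using assms by (simp_all add: delay_condition_def)
  note defs = dc_meet_def dc_join_def dc_serial_def dc_subset_def
  \<comment> \<open>Pick \<open>x\<close> in \<open>j u\<close>; the hypothesis is then used at
    \<open>x\<close>, not at \<open>u\<close>.\<close>
  show "\<forall>u. (i \<circ>\<^sub>D j) u \<inter> U \<noteq> {}" if "\<forall>u. i u \<inter> U \<noteq> {}"
    using that ne(2) unfolding defs by blast
  \<comment> \<open>Equality holds because the condition \<open>y \<in> U\<close> does not mention
    the intermediate signal, so it moves out of the existential.\<close>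
  show "(i \<and>\<^sub>D (\<lambda>_. U)) \<circ>\<^sub>D j = (i \<circ>\<^sub>D j) \<and>\<^sub>D (\<lambda>_. U)"
    unfolding defs by blast
  show "i \<circ>\<^sub>D (j \<and>\<^sub>D (\<lambda>_. U)) \<subseteq>\<^sub>D i \<circ>\<^sub>D j"
    unfolding defs by blast
  \<comment> \<open>Any \<open>x\<close> in \<open>k u\<close> serves both composites; the shared
    output lies in \<open>i x \<inter> j x\<close>.\<close>
  show "\<forall>u. (i \<circ>\<^sub>D k) u \<inter> (j \<circ>\<^sub>D k) u \<noteq> {}" if "\<forall>u. i u \<inter> j u \<noteq> {}"
    using that ne(3) unfolding defs by blast
  show "(i \<and>\<^sub>D j) \<circ>\<^sub>D k \<subseteq>\<^sub>D (i \<circ>\<^sub>D k) \<and>\<^sub>D (j \<circ>\<^sub>D k)"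
    unfolding defs by blast
  \<comment> \<open>Here the intermediate signal is the shared one: take \<open>x\<close> in
    \<open>j u \<inter> k u\<close>, and any \<open>y\<close> in \<open>i x\<close> lies in both
    composites.\<close>
  show "\<forall>u. (i \<circ>\<^sub>D j) u \<inter> (i \<circ>\<^sub>D k) u \<noteq> {}" if "\<forall>u. j u \<inter> k u \<noteq> {}"
    using that ne(1) unfolding defs by blast
  show "i \<circ>\<^sub>D (j \<and>\<^sub>D k) \<subseteq>\<^sub>D (i \<circ>\<^sub>D j) \<and>\<^sub>D (i \<circ>\<^sub>D k)"
    unfolding defs by blast
  show "(i \<or>\<^sub>D j) \<circ>\<^sub>D k = (i \<circ>\<^sub>D k) \<or>\<^sub>D (j \<circ>\<^sub>D k)"
    unfolding defs by blast
  show "i \<circ>\<^sub>D (j \<or>\<^sub>D k) = (i \<circ>\<^sub>D j) \<or>\<^sub>D (i \<circ>\<^sub>D k)"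
    unfolding defs by blast
qed

end
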